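(* Let $p$ be an odd prime, $\zeta = e^{2\pi\sqrt{-1}/p}$, $K = \mathbb{Q}(\zeta) \subset \mathbb{C}$, and let $\mathcal{O}_K = \mathbb{Z}[\zeta]$ be the ring of integers of $K$. Let $u$ be a unit in $\mathcal{O}_K$. Then $u$ is real (i.e. $u \in \mathbb{R}$) if and only if $u$ is primary in $\mathcal{O}_K$.
   Context: Definition of primary: an element $\alpha \in \mathcal{O}_K$ that is prime to $p$ (i.e. the ideals $(\alpha)$ and $(p)$ of $\mathcal{O}_K$ are coprime) is called primary if and only if $\alpha$ is congruent to a rational integer modulo $(1-\zeta)^2$, i.e. there is $a \in \mathbb{Z}$ with $\alpha - a \in (1-\zeta)^2\mathcal{O}_K$. *)

theory Defs
  imports "HOL-Algebra.Generated_Fields" "HOL-Algebra.Algebraic_Closure_Type"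
    "HOL-Analysis.Analysis"
begin

abbreviation complex_ring :: "complex ring" where
  "complex_ring \<equiv> ring_of_type_algebra"

definition zeta :: "nat \<Rightarrow> complex" where
  "zeta p = exp (2 * of_real pi * \<i> / of_nat p)"

(* Q(zeta): every subfield of the complex numbers contains the rationals,
   so generating over {zeta p} alone suffices. *)
definition cyclotomic_field :: "nat \<Rightarrow> complex set" where
  "cyclotomic_field p = generate_field complex_ring {zeta p}"

(* The ring of integers of Q(zeta), i.e. the algebraic integers lying in it, with the operations
   of the complex numbers.  For prime p it is the ring Z[zeta]. *)
definition cyclotomic_integers :: "nat \<Rightarrow> complex ring" where
  "cyclotomic_integers p =
     complex_ring \<lparr>carrier := {x \<in> cyclotomic_field p. algebraic_int x}\<rparr>"

definition coprime_elements :: "('a, 'b) ring_scheme \<Rightarrow> 'a \<Rightarrow> 'a \<Rightarrow> bool" where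
  "coprime_elements R a b \<longleftrightarrow> PIdl\<^bsub>R\<^esub> a <+>\<^bsub>R\<^esub> PIdl\<^bsub>R\<^esub> b = carrier R"

definition primary :: "nat \<Rightarrow> complex \<Rightarrow> bool" where
  "primary p \<alpha> \<longleftrightarrow>
     \<alpha> \<in> carrier (cyclotomic_integers p) \<and>
     coprime_elements (cyclotomic_integers p) \<alpha> (of_nat p) \<and>
     (\<exists>a::int. \<alpha> - of_int a \<in> PIdl\<^bsub>cyclotomic_integers p\<^esub> ((1 - zeta p)\<^sup>2))"

end

theory Submission
  imports Defs "HOL-Number_Theory.Cong" "Jordan_Normal_Form.Char_Poly"
begin

text \<open>
  Write \<open>\<pi> = 1 - \<zeta>\<close>, so that \<open>\<pi>\<^sup>p\<^sup>-\<^sup>1\<close> and \<open>p\<close> are associated in the ring of all algebraic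
  integers.  Hence an integer polynomial of degree below \<open>p - 1\<close> whose value at \<open>\<pi>\<close> is divisible
  by \<open>p\<close> has all coefficients divisible by \<open>p\<close>.  This yields both the linear independence of
  \<open>1, \<zeta>, \<dots>, \<zeta>\<^sup>p\<^sup>-\<^sup>2\<close> over the rationals and, by clearing powers of \<open>p\<close> from a denominator, the
  congruence \<open>x \<equiv> a + b \<pi>\<close> modulo \<open>\<pi>\<^sup>2\<close> with integers \<open>a, b\<close> for every algebraic integer \<open>x\<close> of the
  cyclotomic field, without computing its ring of integers.  Conjugation maps \<open>\<pi>\<close> to \<open>- \<pi>\<close> modulo
  \<open>\<pi>\<^sup>2\<close>, so real elements have \<open>b \<equiv> 0\<close>.

  Conversely, if a unit \<open>u\<close> is congruent to an integer then \<open>v = u / cnj u\<close> is congruent to \<open>1\<close>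
  modulo \<open>\<pi>\<^sup>2\<close>, and all conjugates of \<open>v\<close> have modulus \<open>1\<close>.  Then \<open>p\<close> divides
  \<open>v\<^sup>p - 1 = (\<Prod>k<p. v - \<zeta>\<^sup>k)\<close>, and all conjugates of the quotient have modulus at most \<open>2 / p < 1\<close>,
  so the quotient vanishes.  Thus \<open>v\<close> is a power of \<open>\<zeta>\<close>, and \<open>v \<equiv> 1\<close> forces \<open>v = 1\<close>.
\<close>

subsection \<open>Algebraic integers and divisibility\<close>

text \<open>The equations make \<open>x\<close> an eigenvalue of the integer matrix \<open>c\<close>
  with eigenvector \<open>w\<close>, so \<open>x\<close> is a root of its characteristic polynomial,
  which is monic and integral.\<close>

lemma algebraic_int_if_int_matrix:
  fixes x :: complex and w :: "nat \<Rightarrow> complex" and c :: "nat \<Rightarrow> nat \<Rightarrow> int"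
  assumes eq: "\<And>i. i < n \<Longrightarrow> x * w i = (\<Sum>j<n. of_int (c i j) * w j)"
    and nz: "i0 < n" "w i0 \<noteq> 0"
  shows "algebraic_int x"
proof -
  define A where "A = mat n n (\<lambda>(i, j). c i j)"
  define B :: "complex mat" where "B = map_mat of_int A"
  have A: "A \<in> carrier_mat n n" and B: "B \<in> carrier_mat n n"
    by (simp_all add: A_def B_def)
  have "eigenvector B (Matrix.vec n w) x"
    unfolding eigenvector_def
  proof (intro conjI)
    show "Matrix.vec n w \<in> carrier_vec (dim_row B)"
      using B by simp
    show "Matrix.vec n w \<noteq> 0\<^sub>v (dim_row B)"
      using nz B by (metis carrier_matD(1) index_vec index_zero_vec(1))
    show "B *\<^sub>v Matrix.vec n w = x \<cdot>\<^sub>v Matrix.vec n w"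
      using eq by (intro eq_vecI)
        (auto simp: B_def A_def mult_mat_vec_def scalar_prod_def lessThan_atLeast0)
  qed
  then have "eigenvalue B x"
    unfolding eigenvalue_def by blast
  then have "poly (char_poly B) x = 0"
    using eigenvalue_root_char_poly[OF B] by simp
  moreover have "char_poly B = map_poly of_int (char_poly A)"
    unfolding B_def by (rule of_int_hom.char_poly_hom[OF A])
  ultimately show ?thesis
    unfolding algebraic_int_altdef_ipoly
    using degree_monic_char_poly[OF A] by (intro exI[of _ "char_poly A"]) auto
qed

text \<open>The additive group generated by \<open>W\<close>. Adding one multiple at a time lets
  closure properties be proved by induction, without indexed coefficient families.\<close>

inductive_set int_span :: "complex set \<Rightarrow> complex set" for W where
  zero: "0 \<in> int_span W"
| add: "x \<in> int_span W \<Longrightarrow> w \<in> W \<Longrightarrow> x + of_int c * w \<in> int_span W"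

lemma int_span_base: "w \<in> W \<Longrightarrow> w \<in> int_span W"
  using int_span.add[OF int_span.zero, of w W 1] by simp

lemma int_span_plus:
  assumes "x \<in> int_span W" and "y \<in> int_span W"
  shows "x + y \<in> int_span W"
  using assms(2)
proof (induction y rule: int_span.induct)
  case (add y w c)
  then show ?case
    using int_span.add[of "x + y" W w c] by (simp add: add.assoc)
qed (simp add: assms(1))

lemma int_span_scale: "x \<in> int_span W \<Longrightarrow> of_int k * x \<in> int_span W"
proof (induction x rule: int_span.induct)
  case (add x w c)
  then show ?case
    using int_span.add[of "of_int k * x" W w "k * c"] by (simp add: algebra_simps)
qed (simp add: int_span.zero)

lemma int_span_sum: "(\<And>i. i \<in> I \<Longrightarrow> f i \<in> int_span W) \<Longrightarrow> sum f I \<in> int_span W"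
  by (induction I rule: infinite_finite_induct) (auto intro: int_span_plus int_span.zero)

lemma int_span_mult_closed:
  assumes "\<And>w. w \<in> W \<Longrightarrow> x * w \<in> int_span W" and "y \<in> int_span W"
  shows "x * y \<in> int_span W"
  using assms(2)
proof (induction y rule: int_span.induct)
  case (add y w c)
  then show ?case
    using int_span_plus[OF add.IH int_span_scale[OF assms(1)[OF add.hyps(2)], of c]]
    by (simp add: algebra_simps)
qed (simp add: int_span.zero)

lemma int_span_image_lessThan:
  fixes w :: "nat \<Rightarrow> complex"
  assumes "y \<in> int_span (w ` {..<n})"
  shows "\<exists>c. y = (\<Sum>j<n. of_int (c j) * w j)"
  using assms
proof (induction y rule: int_span.induct)
  case zero
  then show ?case by (intro exI[of _ "\<lambda>_. 0"]) simp
next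
  case (add y v k)
  then obtain c i where c: "y = (\<Sum>j<n. of_int (c j) * w j)" "i < n" "v = w i"
    by blast
  have "(\<Sum>j<n. of_int (c j + (if j = i then k else 0)) * w j)
      = (\<Sum>j<n. of_int (c j) * w j + (if j = i then of_int k * w j else 0))"
    by (intro sum.cong) (auto simp: algebra_simps)
  also have "\<dots> = y + of_int k * v"
    using c sum.delta[of "{..<n}" i "\<lambda>j. of_int k * w j"] by (simp add: sum.distrib)
  finally show ?case by (intro exI) (rule sym)
qed

text \<open>Once \<open>W\<close> is enumerated, the stability condition yields an integer matrix
  with eigenvalue \<open>x\<close>; the element \<open>1\<close> ensures that the eigenvector is
  nonzero.\<close>

lemma algebraic_int_if_stabilises_int_span:
  assumes "finite W" and "1 \<in> W" and stab: "\<And>w. w \<in> W \<Longrightarrow> x * w \<in> int_span W"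
  shows "algebraic_int x"
proof -
  obtain n :: nat and w where w: "W = w ` {..<n}"
    using finite_imp_nat_seg_image_inj_on[OF \<open>finite W\<close>] unfolding lessThan_def by blast
  have "\<forall>i\<in>{..<n}. \<exists>c. x * w i = (\<Sum>j<n. of_int (c j) * w j)"
    using stab int_span_image_lessThan unfolding w by blast
  then obtain c where c: "\<And>i. i < n \<Longrightarrow> x * w i = (\<Sum>j<n. of_int (c i j) * w j)"
    by (auto dest!: bchoice)
  obtain i where "i < n" "w i = 1"
    using \<open>1 \<in> W\<close> w by auto
  then show ?thesis
    using algebraic_int_if_int_matrix[of n x w c i, OF c] by simp
qed

lemma algebraic_int_power_reduction:
  fixes a :: complex
  assumes "algebraic_int a"
  obtains n d where "n > 0" and "a ^ n = (\<Sum>i<n. of_int (d i) * a ^ i)"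
proof -
  obtain q :: "int poly" where q: "poly (map_poly of_int q) a = 0" "lead_coeff q = 1"
    using assms unfolding algebraic_int_altdef_ipoly by blast
  let ?n = "degree q"
  have "0 = (\<Sum>i\<le>?n. of_int (coeff q i) * a ^ i)"
    using q(1) by (simp add: poly_altdef)
  also have "\<dots> = (\<Sum>i<?n. of_int (coeff q i) * a ^ i) + a ^ ?n"
    unfolding lessThan_Suc_atMost[symmetric] sum.lessThan_Suc using q(2) by simp
  finally have eq: "a ^ ?n = (\<Sum>i<?n. of_int (- coeff q i) * a ^ i)"
    by (simp add: sum_negf eq_neg_iff_add_eq_0 add.commute[of "a ^ degree q"])
  \<comment> \<open>A monic constant is \<open>1\<close> and has no root; in \<open>eq\<close> this
    case reads \<open>1 = 0\<close>.\<close>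
  have "?n > 0"
  proof (rule ccontr)
    assume "\<not> ?n > 0"
    then show False
      using eq by simp
  qed
  then show thesis
    using eq that[of ?n "\<lambda>i. - coeff q i"] by blast
qed

text \<open>The ring generated by \<open>a\<close> and \<open>b\<close> is spanned over the integers
  by the finitely many \<open>a ^ i * b ^ j\<close> with \<open>i < n\<close> and
  \<open>j < m\<close>, since the monic relations reduce \<open>a ^ n\<close> and
  \<open>b ^ m\<close>. Multiplication by \<open>a + b\<close> or \<open>a * b\<close> therefore
  stabilises this span.\<close>

lemma algebraic_int_plus_times:
  fixes a b :: complex
  assumes "algebraic_int a" "algebraic_int b"
  shows "algebraic_int (a + b)" and "algebraic_int (a * b)"
proof -
  obtain n d where n: "n > 0" "a ^ n = (\<Sum>i<n. of_int (d i) * a ^ i)"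
    using algebraic_int_power_reduction[OF assms(1)] by blast
  obtain m e where m: "m > 0" "b ^ m = (\<Sum>i<m. of_int (e i) * b ^ i)"
    using algebraic_int_power_reduction[OF assms(2)] by blast
  define W where "W = (\<lambda>(i, j). a ^ i * b ^ j) ` ({..<n} \<times> {..<m})"
  have base: "a ^ i * b ^ j \<in> int_span W" if "i < n" "j < m" for i j
    using that by (intro int_span_base) (auto simp: W_def)
  have a: "a * w \<in> int_span W" if w: "w \<in> W" for w
  proof -
    obtain i j where ij: "i < n" "j < m" "w = a ^ i * b ^ j"
      using w by (auto simp: W_def)
    show ?thesis
    proof (cases "Suc i < n")
      case True
      then show ?thesis using base[of "Suc i" j] ij by (simp add: mult.assoc)
    next
      case False
      then have "n = Suc i"
        using ij by simp
      then have "a * w = a ^ n * b ^ j"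
        using ij by simp
      also have "\<dots> = (\<Sum>i<n. of_int (d i) * (a ^ i * b ^ j))"
        by (simp add: n(2) sum_distrib_right mult.assoc)
      finally show ?thesis
        using ij base by (auto intro!: int_span_sum int_span_scale)
    qed
  qed
  have b: "b * w \<in> int_span W" if w: "w \<in> W" for w
  proof -
    obtain i j where ij: "i < n" "j < m" "w = a ^ i * b ^ j"
      using w by (auto simp: W_def)
    show ?thesis
    proof (cases "Suc j < m")
      case True
      then show ?thesis using base[of i "Suc j"] ij by (simp add: mult_ac)
    next
      case False
      then have "m = Suc j"
        using ij by simp
      then have "b * w = a ^ i * b ^ m"
        using ij by simp
      also have "\<dots> = (\<Sum>j<m. of_int (e j) * (a ^ i * b ^ j))"
        by (simp add: m(2) sum_distrib_left mult_ac)
      finally show ?thesis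
        using ij base by (auto intro!: int_span_sum int_span_scale)
    qed
  qed
  have "finite W"
    by (simp add: W_def)
  moreover have "1 \<in> W"
    unfolding W_def using n(1) m(1) by (intro image_eqI[of _ _ "(0, 0)"]) simp_all
  ultimately have W: "finite W" "1 \<in> W"
    by blast+
  show "algebraic_int (a + b)"
    using a b by (intro algebraic_int_if_stabilises_int_span[OF W])
      (auto simp: distrib_right intro: int_span_plus)
  show "algebraic_int (a * b)"
    using int_span_mult_closed[OF a b] by (intro algebraic_int_if_stabilises_int_span[OF W])
      (simp add: mult.assoc)
qed

section \<open>Closure properties and divisibility of algebraic integers\<close>

lemmas algebraic_int_plus [intro] = algebraic_int_plus_times(1)
lemmas algebraic_int_times [intro] = algebraic_int_plus_times(2)

lemma algebraic_int_diff [intro]: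
  fixes a b :: complex
  shows "algebraic_int a \<Longrightarrow> algebraic_int b \<Longrightarrow> algebraic_int (a - b)"
  using algebraic_int_plus[of a "- b"] by simp

lemma algebraic_int_power [intro]: "algebraic_int (a :: complex) \<Longrightarrow> algebraic_int (a ^ n)"
  by (induction n) auto

lemma algebraic_int_sum [intro]:
  fixes f :: "'a \<Rightarrow> complex"
  shows "(\<And>i. i \<in> I \<Longrightarrow> algebraic_int (f i)) \<Longrightarrow> algebraic_int (sum f I)"
  by (induction I rule: infinite_finite_induct) auto

lemma algebraic_int_poly [intro]:
  "algebraic_int x \<Longrightarrow> algebraic_int (poly (map_poly of_int q) (x :: complex))"
  by (induction q) (auto simp: map_poly_pCons)

text \<open>The quotient may be any algebraic integer, inside the cyclotomic field or not. This
  keeps field membership out of the divisibility arguments;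
  \<open>pi_squared_alg_dvd_imp_mem_PIdl\<close> restores it at the end.\<close>

definition alg_dvd :: "complex \<Rightarrow> complex \<Rightarrow> bool" where
  "alg_dvd x y \<longleftrightarrow> (\<exists>z. algebraic_int z \<and> y = x * z)"

lemma alg_dvdI: "algebraic_int z \<Longrightarrow> y = x * z \<Longrightarrow> alg_dvd x y"
  unfolding alg_dvd_def by blast

lemma alg_dvd_refl [simp]: "alg_dvd x x"
  by (intro alg_dvdI[of 1]) auto

lemma alg_dvd_0 [simp]: "alg_dvd x 0"
  by (intro alg_dvdI[of 0]) auto

lemma alg_dvd_trans [trans]: "alg_dvd x y \<Longrightarrow> alg_dvd y z \<Longrightarrow> alg_dvd x z"
  unfolding alg_dvd_def by (auto simp: mult.assoc)

lemma alg_dvd_add: "alg_dvd x y \<Longrightarrow> alg_dvd x z \<Longrightarrow> alg_dvd x (y + z)"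
  unfolding alg_dvd_def by (metis algebraic_int_plus distrib_left)

lemma alg_dvd_diff: "alg_dvd x y \<Longrightarrow> alg_dvd x z \<Longrightarrow> alg_dvd x (y - z)"
  unfolding alg_dvd_def by (metis algebraic_int_diff right_diff_distrib)

lemma alg_dvd_sum: "(\<And>i. i \<in> I \<Longrightarrow> alg_dvd x (f i)) \<Longrightarrow> alg_dvd x (sum f I)"
  by (induction I rule: infinite_finite_induct) (auto intro: alg_dvd_add)

lemma alg_dvd_mult: "alg_dvd x y \<Longrightarrow> alg_dvd x' y' \<Longrightarrow> alg_dvd (x * x') (y * y')"
  unfolding alg_dvd_def by (metis algebraic_int_times mult.assoc mult.left_commute)

lemma alg_dvd_mult_right: "alg_dvd x y \<Longrightarrow> algebraic_int z \<Longrightarrow> alg_dvd x (y * z)"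
  unfolding alg_dvd_def by (metis algebraic_int_times mult.assoc)

lemma alg_dvd_power: "alg_dvd x y \<Longrightarrow> alg_dvd (x ^ n) (y ^ n)"
  by (induction n) (auto intro: alg_dvd_mult)

lemma alg_dvd_prod:
  "(\<And>i. i \<in> I \<Longrightarrow> alg_dvd (f i) (g i)) \<Longrightarrow> alg_dvd (prod f I) (prod g I)"
  by (induction I rule: infinite_finite_induct) (auto intro: alg_dvd_mult)

lemma alg_dvd_power_le:
  "m \<le> n \<Longrightarrow> algebraic_int x \<Longrightarrow> alg_dvd (x ^ m) (x ^ n)"
  by (intro alg_dvdI[of "x ^ (n - m)"]) (auto simp flip: power_add)

lemma alg_dvd_cancel: "c \<noteq> 0 \<Longrightarrow> alg_dvd (c * x) (c * y) \<Longrightarrow> alg_dvd x y"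
  unfolding alg_dvd_def by auto

lemma alg_dvd_of_int_iff:
  "alg_dvd (of_int m) (of_int n) \<longleftrightarrow> m dvd n"
proof
  assume "alg_dvd (of_int m) (of_int n)"
  then obtain z where z: "algebraic_int z" "(of_int n :: complex) = of_int m * z"
    unfolding alg_dvd_def by blast
  show "m dvd n"
  proof (cases "m = 0")
    case False
    then have "z = of_int n / of_int m"
      using z(2) by simp
    then have "z \<in> \<rat>"
      by simp
    then obtain k where "z = of_int k"
      using rational_algebraic_int_is_int[OF z(1)] by (auto elim: Ints_cases)
    then have "(of_int n :: complex) = of_int (m * k)"
      using z(2) by simp
    then show ?thesis
      unfolding of_int_eq_iff by simp
  qed (use z in auto)
next
  assume "m dvd n"
  then show "alg_dvd (of_int m) (of_int n)"
    by (auto elim!: dvdE intro: alg_dvdI)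
qed

subsection \<open>The prime \<open>\<pi>\<close> above \<open>p\<close>\<close>

text \<open>Field elements are represented by rational polynomials: the conjugates of
  \<open>ev f \<zeta>\<close> are the values \<open>ev f (\<zeta> ^ k)\<close>, so no Galois group
  has to be constructed.\<close>

definition ev :: "rat poly \<Rightarrow> complex \<Rightarrow> complex" where
  "ev f z = poly (map_poly of_rat f) z"

lemma ev_simps [simp]:
  "ev 0 z = 0" "ev 1 z = 1" "ev (f + g) z = ev f z + ev g z" "ev (- f) z = - ev f z"
  "ev (f - g) z = ev f z - ev g z" "ev (f * g) z = ev f z * ev g z"
  "ev (f ^ n) z = ev f z ^ n" "ev (smult c f) z = of_rat c * ev f z"
  "ev (pCons c f) z = of_rat c + z * ev f z" "ev (monom c n) z = of_rat c * z ^ n"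
  "ev (pcompose f g) z = ev f (ev g z)"
proof -
  interpret map_poly_comm_ring_hom "of_rat :: rat \<Rightarrow> complex" ..
  show "ev 0 z = 0" "ev 1 z = 1" "ev (f + g) z = ev f z + ev g z" "ev (- f) z = - ev f z"
    "ev (f - g) z = ev f z - ev g z" "ev (f * g) z = ev f z * ev g z"
    "ev (f ^ n) z = ev f z ^ n" "ev (smult c f) z = of_rat c * ev f z"
    "ev (pCons c f) z = of_rat c + z * ev f z" "ev (monom c n) z = of_rat c * z ^ n"
    "ev (pcompose f g) z = ev f (ev g z)"
    by (simp_all add: ev_def hom_distribs poly_monom poly_pcompose)
qed

lemma ev_sum: "ev (sum f A) z = (\<Sum>i\<in>A. ev (f i) z)"
  by (induction A rule: infinite_finite_induct) simp_all

lemma ev_of_int_poly: "ev (map_poly of_int q) z = poly (map_poly of_int q) z"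
  by (simp add: ev_def map_poly_map_poly o_def)

lemma cnj_ev: "cnj (ev f z) = ev f (cnj z)"
proof -
  have "cnj (of_rat c) = of_rat c" for c
    by (cases c) (simp add: of_rat_rat)
  then show ?thesis
    by (induction f) simp_all
qed

lemma rat_poly_common_denominator:
  obtains d :: int and q :: "int poly"
  where "d > 0" and "map_poly of_int q = smult (of_int d) (f :: rat poly)"
proof (induction f arbitrary: thesis)
  case 0
  show ?case by (rule 0[of 1 0]) simp_all
next
  case (pCons c f)
  obtain d :: int and q :: "int poly"
    where q: "d > 0" "map_poly of_int q = smult (of_int d) f"
    using pCons.IH by blast
  obtain a b :: int where ab: "b > 0" "c = of_int a / of_int b"
    by (metis Fract_of_int_quotient Rat_cases)
  show ?case
  proof (rule pCons.prems)
    show "d * b > 0"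
      using q ab by simp
    show "map_poly of_int (pCons (d * a) (smult b q)) = smult (of_int (d * b)) (pCons c f)"
      using q ab by (simp add: hom_distribs mult_ac)
  qed
qed

section \<open>Powers of \<zeta> and the factorization of \<open>p\<close>\<close>

locale odd_prime =
  fixes p :: nat
  assumes prime_p: "Factorial_Ring.prime p" and odd_p: "odd p"
begin

abbreviation \<zeta> :: complex where "\<zeta> \<equiv> zeta p"
abbreviation \<pi> :: complex where "\<pi> \<equiv> 1 - zeta p"

lemma p_ge_3: "p \<ge> 3"
proof -
  have "p \<ge> 2" using prime_p by (rule prime_ge_2_nat)
  moreover have "p \<noteq> 2" using odd_p by auto
  ultimately show ?thesis by simp
qed

lemma zeta_power: "\<zeta> ^ k = cis (2 * pi * real k / real p)"
proof -
  have "\<zeta> = cis (2 * pi / real p)"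
    by (simp add: zeta_def cis_conv_exp mult_ac)
  then show ?thesis
    by (simp add: Complex.DeMoivre mult_ac)
qed

lemma zeta_bij: "bij_betw (\<lambda>k. \<zeta> ^ k) {..<p} {z. z ^ p = 1}"
  unfolding zeta_power using Complex.bij_betw_roots_unity[of p] p_ge_3 by simp

lemma zeta_power_p [simp]: "\<zeta> ^ p = 1"
  using zeta_power[of p] p_ge_3 by simp

lemma zeta_nonzero [simp]: "\<zeta> \<noteq> 0"
  by (simp add: zeta_def)

lemma zeta_power_mod: "\<zeta> ^ (k mod p) = \<zeta> ^ k"
proof -
  have "\<zeta> ^ k = \<zeta> ^ (p * (k div p) + k mod p)"
    by simp
  also have "\<dots> = \<zeta> ^ (k mod p)"
    unfolding power_add power_mult by simp
  finally show ?thesis ..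
qed

lemma zeta_power_eq_1_iff: "\<zeta> ^ k = 1 \<longleftrightarrow> p dvd k"
proof -
  have "\<zeta> ^ k = 1 \<longleftrightarrow> \<zeta> ^ (k mod p) = \<zeta> ^ 0"
    by (simp add: zeta_power_mod)
  also have "\<dots> \<longleftrightarrow> k mod p = 0"
    using bij_betw_imp_inj_on[OF zeta_bij] p_ge_3
    by (intro inj_on_eq_iff[of "\<lambda>k. \<zeta> ^ k" "{..<p}"]) auto
  finally show ?thesis by (simp add: dvd_eq_mod_eq_0)
qed

lemma zeta_neq_1 [simp]: "\<zeta> \<noteq> 1"
  using zeta_power_eq_1_iff[of 1] p_ge_3 by simp

lemma algebraic_int_zeta [simp, intro]: "algebraic_int \<zeta>"
proof (rule algebraic_int_root)
  show "poly (monom 1 p) \<zeta> = 1"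
    by (simp add: poly_monom)
  show "degree (monom (1 :: complex) p) > 0" "lead_coeff (monom (1 :: complex) p) = 1"
    using p_ge_3 by (simp_all add: degree_monom_eq)
  show "\<forall>i. coeff (monom (1 :: complex) p) i \<in> \<int>"
    by simp
qed simp

lemma algebraic_int_pi [simp, intro]: "algebraic_int \<pi>"
  by (intro algebraic_int_diff) auto

lemma cnj_zeta: "cnj \<zeta> = \<zeta> ^ (p - 1)"
proof -
  have "\<zeta> * cnj \<zeta> = 1"
    using zeta_power[of 1] by (simp add: cis_cnj cis_mult)
  moreover have "\<zeta> * \<zeta> ^ (p - 1) = 1"
    using p_ge_3 by (simp flip: power_Suc)
  ultimately have "\<zeta> * cnj \<zeta> = \<zeta> * \<zeta> ^ (p - 1)"
    by simp
  then show ?thesis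
    unfolding mult_cancel_left by simp
qed

text \<open>Both sides are monic polynomials of degree \<open>p - 1\<close> that vanish at the
  \<open>p - 1\<close> nontrivial \<open>p\<close>-th roots of unity.\<close>

lemma sum_powers_eq_prod: "(\<Sum>i<p. z ^ i) = (\<Prod>k\<in>{1..<p}. z - \<zeta> ^ k)"
proof -
  define P :: "complex poly" where "P = (\<Sum>i<p. monom 1 i)"
  define Q :: "complex poly" where "Q = (\<Prod>k\<in>{1..<p}. [:- (\<zeta> ^ k), 1:])"
  have poly: "poly P z = (\<Sum>i<p. z ^ i)" "poly Q z = (\<Prod>k\<in>{1..<p}. z - \<zeta> ^ k)" for z
    by (simp_all add: P_def Q_def poly_sum poly_monom poly_prod)
  have deg_Q: "degree Q = p - 1"
    unfolding Q_def by (subst degree_prod_sum_eq) auto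
  have "P = Q"
  proof (rule poly_eqI_degree_lead_coeff[where n = "p - 1" and A = "(\<lambda>k. \<zeta> ^ k) ` {1..<p}"])
    have "coeff P (p - 1) = (\<Sum>i<p. if i = p - 1 then 1 else 0)"
      unfolding P_def coeff_sum by (intro sum.cong) auto
    then have "coeff P (p - 1) = 1"
      using p_ge_3 by simp
    moreover have "lead_coeff Q = 1"
      unfolding Q_def lead_coeff_prod by simp
    ultimately show "coeff P (p - 1) = coeff Q (p - 1)"
      by (simp add: deg_Q)
    have "inj_on (\<lambda>k. \<zeta> ^ k) {1..<p}"
      by (rule inj_on_subset[OF bij_betw_imp_inj_on[OF zeta_bij]]) auto
    then show "p - 1 \<le> card ((\<lambda>k. \<zeta> ^ k) ` {1..<p})"
      by (simp add: card_image)
    show "degree P \<le> p - 1"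
      unfolding P_def by (intro degree_sum_le) (auto intro: order.trans[OF degree_monom_le])
    show "degree Q \<le> p - 1"
      by (simp add: deg_Q)
  next
    fix z assume "z \<in> (\<lambda>k. \<zeta> ^ k) ` {1..<p}"
    then obtain k where k: "k \<in> {1..<p}" "z = \<zeta> ^ k"
      by blast
    have "z ^ p = 1"
      by (simp add: k flip: power_mult) (simp add: mult.commute[of k] power_mult)
    then have "(z - 1) * (\<Sum>i<p. z ^ i) = 0"
      by (simp flip: power_diff_1_eq)
    moreover have "z \<noteq> 1"
      using k zeta_power_eq_1_iff[of k] by (auto dest: dvd_imp_le)
    ultimately have "(\<Sum>i<p. z ^ i) = 0"
      by simp
    moreover have "(\<Prod>k\<in>{1..<p}. z - \<zeta> ^ k) = 0"
      using k by (intro prod_zero) auto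
    ultimately show "poly P z = poly Q z"
      by (simp add: poly)
  qed
  then show ?thesis
    using poly[of z] by simp
qed

lemma p_eq_prod: "of_nat p = (\<Prod>k\<in>{1..<p}. 1 - \<zeta> ^ k)"
  using sum_powers_eq_prod[of 1] by simp

lemma power_p_diff_1_eq_prod: "z ^ p - 1 = (\<Prod>k<p. z - \<zeta> ^ k)"
proof -
  have "(\<Prod>k<p. z - \<zeta> ^ k) = (\<Prod>k\<in>insert 0 {1..<p}. z - \<zeta> ^ k)"
    using p_ge_3 by (intro prod.cong) auto
  also have "\<dots> = (z - 1) * (\<Sum>i<p. z ^ i)"
    by (subst prod.insert) (auto simp: sum_powers_eq_prod)
  finally show ?thesis
    by (simp add: power_diff_1_eq)
qed

lemma alg_dvd_one_minus_zeta_power: "alg_dvd \<pi> (1 - \<zeta> ^ k)"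
proof (rule alg_dvdI)
  show "1 - \<zeta> ^ k = \<pi> * (\<Sum>i<k. \<zeta> ^ i)"
    by (rule one_diff_power_eq)
  show "algebraic_int (\<Sum>i<k. \<zeta> ^ i)"
    by (intro algebraic_int_sum algebraic_int_power algebraic_int_zeta)
qed

text \<open>With \<open>l\<close> inverse to \<open>k\<close> modulo \<open>p\<close>, \<zeta> is
  the \<open>l\<close>-th power of \<open>\<zeta> ^ k\<close>, so the quotient is a geometric
  sum.\<close>

lemma one_minus_zeta_power_alg_dvd:
  assumes "k \<in> {1..<p}"
  shows "alg_dvd (1 - \<zeta> ^ k) \<pi>"
proof -
  have "\<not> p dvd k"
    using assms by (auto dest: dvd_imp_le)
  then have "coprime k p"
    using prime_imp_coprime[OF prime_p] coprime_commute by blast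
  then obtain l where "[k * l = 1] (mod p)"
    using cong_solve_coprime_nat[of k p] by auto
  then have "\<zeta> ^ (k * l) = \<zeta> ^ 1"
    using zeta_power_mod[of "k * l"] zeta_power_mod[of 1] by (simp add: cong_def)
  then have "\<pi> = 1 - (\<zeta> ^ k) ^ l"
    by (simp flip: power_mult)
  also have "\<dots> = (1 - \<zeta> ^ k) * (\<Sum>i<l. (\<zeta> ^ k) ^ i)"
    by (rule one_diff_power_eq)
  finally show ?thesis
    by (rule alg_dvdI[rotated]) (intro algebraic_int_sum algebraic_int_power algebraic_int_zeta)
qed

text \<open>Each of the \<open>p - 1\<close> factors of \<open>p\<close> in \<open>p_eq_prod\<close>
  is associated to \<pi>.\<close>

lemma pi_power_alg_dvd_p: "alg_dvd (\<pi> ^ (p - 1)) (of_nat p)"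
  and p_alg_dvd_pi_power: "alg_dvd (of_nat p) (\<pi> ^ (p - 1))"
proof -
  have *: "\<pi> ^ (p - 1) = (\<Prod>k\<in>{1..<p}. \<pi>)"
    by simp
  show "alg_dvd (\<pi> ^ (p - 1)) (of_nat p)"
    unfolding p_eq_prod * by (intro alg_dvd_prod alg_dvd_one_minus_zeta_power)
  show "alg_dvd (of_nat p) (\<pi> ^ (p - 1))"
    unfolding p_eq_prod * by (intro alg_dvd_prod one_minus_zeta_power_alg_dvd)
qed

lemma pi_power_alg_dvd_p_le: "i < p \<Longrightarrow> alg_dvd (\<pi> ^ i) (of_nat p)"
  by (rule alg_dvd_trans[OF alg_dvd_power_le pi_power_alg_dvd_p]) auto

lemma pi_alg_dvd_of_int_iff: "alg_dvd \<pi> (of_int b) \<longleftrightarrow> int p dvd b"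
proof
  assume "alg_dvd \<pi> (of_int b)"
  then have "alg_dvd (\<pi> ^ (p - 1)) (of_int b ^ (p - 1))"
    by (rule alg_dvd_power)
  with p_alg_dvd_pi_power have "alg_dvd (of_nat p) (of_int b ^ (p - 1))"
    by (rule alg_dvd_trans)
  \<comment> \<open>Divisibility between rational integers is the same in all algebraic integers, so
    primality of \<open>p\<close> can now be used.\<close>
  then have "int p dvd b ^ (p - 1)"
    using alg_dvd_of_int_iff[of "int p" "b ^ (p - 1)"] by simp
  moreover have "Factorial_Ring.prime (int p)"
    using prime_p by simp
  ultimately show "int p dvd b"
    using prime_dvd_power by blast
next
  assume "int p dvd b"
  then have "alg_dvd (of_nat p) (of_int b)"
    using alg_dvd_of_int_iff[of "int p" b] by simp
  then show "alg_dvd \<pi> (of_int b)"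
    using alg_dvd_trans pi_power_alg_dvd_p_le[of 1] p_ge_3 by simp
qed

text \<open>Modulo \<open>\<pi>\<^sup>i\<^sup>+\<^sup>1\<close>, which divides \<open>p\<close>, only the \<open>i\<close>-th term survives once the earlier
  coefficients are known to be divisible by \<open>p\<close>.\<close>

lemma p_dvd_coeff_if_p_alg_dvd_poly_pi:
  fixes B :: "int poly"
  assumes deg: "degree B < p - 1" and dvd: "alg_dvd (of_nat p) (poly (map_poly of_int B) \<pi>)"
  shows "int p dvd coeff B i"
proof (induction i rule: less_induct)
  case (less i)
  show ?case
  proof (cases "i < p - 1")
    case False
    then show ?thesis
      using deg by (simp add: coeff_eq_0)
  next
    case True
    let ?t = "\<lambda>j. of_int (coeff B j) * \<pi> ^ j"
    have "poly (map_poly of_int B) \<pi> = (\<Sum>j\<le>degree B. ?t j)"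
      by (simp add: poly_altdef)
    also have "\<dots> = (\<Sum>j<p - 1. ?t j)"
      using deg by (intro sum.mono_neutral_left) (auto simp: coeff_eq_0)
    also have "\<dots> = ?t i + (\<Sum>j\<in>{..<p - 1} - {i}. ?t j)"
      using True by (intro sum.remove) auto
    finally have eq: "?t i = poly (map_poly of_int B) \<pi> - (\<Sum>j\<in>{..<p - 1} - {i}. ?t j)"
      by simp
    have "alg_dvd (\<pi> ^ Suc i) (?t j)" if "j \<in> {..<p - 1} - {i}" for j
    proof (cases "j < i")
      case True
      have "alg_dvd (\<pi> ^ Suc i) (of_nat p)"
        using \<open>i < p - 1\<close> by (intro pi_power_alg_dvd_p_le) simp
      also have "alg_dvd (of_nat p) (of_int (coeff B j))"
        using less.IH[OF True] alg_dvd_of_int_iff[of "int p"] by simp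
      finally show ?thesis
        by (rule alg_dvd_mult_right) auto
    next
      case False
      then have "alg_dvd (\<pi> ^ Suc i) (\<pi> ^ j)"
        using that by (intro alg_dvd_power_le) auto
      then show ?thesis
        using alg_dvd_mult_right[of _ "\<pi> ^ j" "of_int (coeff B j)"] by (simp add: mult.commute)
    qed
    moreover have "alg_dvd (\<pi> ^ Suc i) (poly (map_poly of_int B) \<pi>)"
      using True by (intro alg_dvd_trans[OF pi_power_alg_dvd_p_le dvd]) simp
    ultimately have "alg_dvd (\<pi> ^ Suc i) (?t i)"
      unfolding eq by (intro alg_dvd_diff alg_dvd_sum) auto
    then have "alg_dvd (\<pi> ^ i * \<pi>) (\<pi> ^ i * of_int (coeff B i))"
      by (simp add: mult.commute)
    then have "alg_dvd \<pi> (of_int (coeff B i))"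
      by (rule alg_dvd_cancel[rotated]) simp
    then show ?thesis
      by (simp add: pi_alg_dvd_of_int_iff)
  qed
qed

subsection \<open>Conjugates and traces\<close>

text \<open>The \<open>p\<close>-th cyclotomic polynomial.\<close>

definition cyc :: "rat poly" where "cyc = (\<Sum>i<p. monom 1 i)"

lemma ev_cyc: "ev cyc z = (\<Sum>i<p. z ^ i)"
  by (simp add: cyc_def ev_sum)

lemma degree_cyc: "degree cyc = p - 1"
proof (rule antisym)
  show "degree cyc \<le> p - 1"
    unfolding cyc_def by (intro degree_sum_le) (auto intro: order.trans[OF degree_monom_le])
  have "coeff cyc (p - 1) = (\<Sum>i<p. if i = p - 1 then 1 else 0)"
    unfolding cyc_def coeff_sum by (intro sum.cong) auto
  then have "coeff cyc (p - 1) = 1"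
    using p_ge_3 by simp
  then show "p - 1 \<le> degree cyc"
    by (intro le_degree) simp
qed

lemma cyc_nonzero: "cyc \<noteq> 0"
  using degree_cyc p_ge_3 by auto

lemma ev_cyc_zeta_power: "\<not> p dvd k \<Longrightarrow> ev cyc (\<zeta> ^ k) = 0"
proof -
  assume "\<not> p dvd k"
  then have "\<zeta> ^ k \<noteq> 1"
    by (simp add: zeta_power_eq_1_iff)
  moreover have "(\<zeta> ^ k) ^ p = 1"
    by (metis power_commutes power_mult power_one mult.commute zeta_power_p)
  ultimately show ?thesis
    using power_diff_1_eq[of "\<zeta> ^ k" p] by (simp add: ev_cyc)
qed

lemma ev_cyc_zeta: "ev cyc \<zeta> = 0"
  using ev_cyc_zeta_power[of 1] p_ge_3 by simp

lemma ev_mod_cyc: "\<not> p dvd k \<Longrightarrow> ev (f mod cyc) (\<zeta> ^ k) = ev f (\<zeta> ^ k)"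
proof -
  assume k: "\<not> p dvd k"
  have "ev f (\<zeta> ^ k) = ev (f div cyc * cyc + f mod cyc) (\<zeta> ^ k)"
    by (simp only: div_mult_mod_eq)
  also have "\<dots> = ev (f mod cyc) (\<zeta> ^ k)"
    unfolding ev_simps ev_cyc_zeta_power[OF k] by simp
  finally show ?thesis ..
qed

lemma ev_mod_cyc_zeta: "ev (f mod cyc) \<zeta> = ev f \<zeta>"
  using ev_mod_cyc[of 1 f] p_ge_3 by simp

lemma degree_mod_cyc: "degree (f mod cyc) < p - 1"
  using degree_mod_less[OF cyc_nonzero, of f] degree_cyc p_ge_3 by auto

text \<open>Substituting \<open>1 - X\<close> turns evaluation at \<zeta> into evaluation at \<pi>
  and preserves the degree; clearing denominators then gives \<open>q\<close>.\<close>

lemma pi_representation: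
  obtains d :: int and q :: "int poly"
  where "d > 0" and "degree q = degree f" and "q = 0 \<longleftrightarrow> f = 0"
    and "poly (map_poly of_int q) \<pi> = of_int d * ev f \<zeta>"
proof -
  define g where "g = pcompose f [:1, -1:]"
  obtain d :: int and q :: "int poly"
    where q: "d > 0" "map_poly of_int q = smult (of_int d) g"
    by (rule rat_poly_common_denominator)
  show thesis
  proof (rule that)
    have "degree q = degree (map_poly rat_of_int q)"
      by simp
    also have "\<dots> = degree f"
      using q by (simp add: g_def degree_pcompose)
    finally show "degree q = degree f" .
    have "q = 0 \<longleftrightarrow> map_poly rat_of_int q = 0"
      by simp
    also have "\<dots> \<longleftrightarrow> f = 0"
      using q by (simp add: g_def pcompose_eq_0_iff)
    finally show "q = 0 \<longleftrightarrow> f = 0" .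
    have "poly (map_poly of_int q) \<pi> = ev (smult (of_int d) g) \<pi>"
      by (simp flip: q(2) add: ev_of_int_poly)
    then show "poly (map_poly of_int q) \<pi> = of_int d * ev f \<zeta>"
      by (simp add: g_def)
  qed (rule q)
qed

text \<open>A nonzero relation would give a primitive integer polynomial vanishing at \<pi>. As
  \<open>p\<close> divides \<open>0\<close>, it divides all coefficients, contradicting content
  \<open>1\<close>.\<close>

lemma ev_zeta_eq_0_imp_eq_0:
  assumes deg: "degree f < p - 1" and zero: "ev f \<zeta> = 0"
  shows "f = 0"
proof (rule ccontr)
  assume "f \<noteq> 0"
  obtain d :: int and q :: "int poly" where deg_q: "degree q = degree f" and "q = 0 \<longleftrightarrow> f = 0"
    and "poly (map_poly of_int q) \<pi> = of_int d * ev f \<zeta>"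
    by (rule pi_representation)
  then have "q \<noteq> 0" and q_zero: "poly (map_poly of_int q) \<pi> = 0"
    using \<open>f \<noteq> 0\<close> zero by simp_all
  define B where "B = primitive_part q"
  have "map_poly of_int q = smult (of_int (Polynomial.content q)) (map_poly (of_int :: int \<Rightarrow> complex) B)"
    unfolding B_def of_int_hom.map_poly_hom_smult[symmetric] content_times_primitive_part ..
  then have "poly (map_poly of_int B) \<pi> = 0"
    using q_zero \<open>q \<noteq> 0\<close> by simp
  then have "int p dvd coeff B i" for i
    using deg deg_q by (intro p_dvd_coeff_if_p_alg_dvd_poly_pi) (simp_all add: B_def)
  then have "[:int p:] dvd B"
    by (simp add: const_poly_dvd_iff)
  then have "int p dvd Polynomial.content B"
    by (simp add: const_poly_dvd_iff_dvd_content)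
  moreover have "Polynomial.content B = 1"
    using \<open>q \<noteq> 0\<close> by (simp add: B_def)
  ultimately show False
    using p_ge_3 by simp
qed

text \<open>A rational relation at \<zeta> is a multiple of \<open>cyc\<close>, hence passes to
  every nontrivial power of \<zeta>. This replaces the Galois action.\<close>

lemma ev_zeta_power_eq_0:
  assumes "ev f \<zeta> = 0" and "\<not> p dvd k"
  shows "ev f (\<zeta> ^ k) = 0"
proof -
  have "f mod cyc = 0"
    using ev_zeta_eq_0_imp_eq_0[OF degree_mod_cyc] assms(1) by (simp add: ev_mod_cyc_zeta)
  then show ?thesis
    using ev_mod_cyc[OF assms(2), of f] by simp
qed

text \<open>Dividing the cyclotomic polynomial by a representative of \<open>f\<close> leaves a remainder of smaller
  degree that represents a nonzero multiple of \<open>f\<close>.\<close>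

lemma ev_zeta_inverse: "ev f \<zeta> \<noteq> 0 \<Longrightarrow> \<exists>g. ev g \<zeta> = inverse (ev f \<zeta>)"
proof (induction "degree (f mod cyc)" arbitrary: f rule: less_induct)
  case less
  define h where "h = f mod cyc"
  have h: "ev h \<zeta> = ev f \<zeta>" "degree h < p - 1"
    using degree_mod_cyc[of f] by (simp_all add: h_def ev_mod_cyc_zeta)
  have h_nz: "h \<noteq> 0"
    using less.prems h(1) by auto
  show ?case
  proof (cases "degree h = 0")
    case True
    then obtain c where "h = [:c:]"
      by (auto elim: degree_eq_zeroE)
    then show ?thesis
      using h(1) by (intro exI[of _ "[:inverse c:]"]) (simp flip: h(1) add: of_rat_inverse)
  next
    case False
    define q r where "q = cyc div h" and "r = cyc mod h"
    have eq: "cyc = q * h + r"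
      by (simp add: q_def r_def)
    have deg_r: "degree r < degree h"
      using degree_mod_less'[of h cyc] h_nz False by (cases "r = 0") (auto simp: r_def)
    \<comment> \<open>Otherwise \<open>cyc = r\<close> would have degree below \<open>p - 1\<close>.
      Since \<open>h\<close> is not constant, \<open>q\<close> also has degree below
      \<open>p - 1\<close>, so its value at \<zeta> is nonzero and can be inverted.\<close>
    have "q \<noteq> 0"
      using eq deg_r h(2) degree_cyc by auto
    then have "degree cyc = degree q + degree h"
      unfolding eq using deg_r h_nz by (simp add: degree_add_eq_left degree_mult_eq)
    then have deg_q: "degree q < p - 1"
      using False degree_cyc by simp
    then have "ev q \<zeta> \<noteq> 0"
      using ev_zeta_eq_0_imp_eq_0 \<open>q \<noteq> 0\<close> by blast
    have r: "ev r \<zeta> = - (ev q \<zeta> * ev f \<zeta>)"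
      using ev_cyc_zeta h(1) unfolding eq by (simp add: eq_neg_iff_add_eq_0 add.commute)
    have "r mod cyc = r"
      using deg_r h(2) degree_cyc by (intro mod_poly_less) simp
    then obtain g where g: "ev g \<zeta> = inverse (ev r \<zeta>)"
      using less.hyps[of r] deg_r r \<open>ev q \<zeta> \<noteq> 0\<close> less.prems by (auto simp: h_def)
    have "ev (- (q * g)) \<zeta> = inverse (ev f \<zeta>)"
      using \<open>ev q \<zeta> \<noteq> 0\<close> by (simp add: g r)
    then show ?thesis by blast
  qed
qed

section \<open>Expansion of algebraic integers modulo the square of \<pi>\<close>

lemma pi_power_2_alg_dvd_p: "alg_dvd (\<pi>\<^sup>2) (of_nat p)"
  using p_ge_3 by (intro pi_power_alg_dvd_p_le) simp

text \<open>If \<open>p\<close> divides \<open>n\<close>, it divides the value of \<open>B\<close>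
  at \<pi> and hence every coefficient of \<open>B\<close>. Cancelling \<open>p\<close> on both
  sides gives a smaller denominator.\<close>

lemma clear_p_from_denominator:
  assumes "algebraic_int x" "n > 0"
    "of_nat n * x = poly (map_poly of_int B) \<pi>" "degree (B :: int poly) < p - 1"
  shows "\<exists>m C. \<not> p dvd m \<and> of_nat m * x = poly (map_poly of_int C) \<pi>"
  using assms(2-)
proof (induction n arbitrary: B rule: less_induct)
  case (less n)
  show ?case
  proof (cases "p dvd n")
    case False
    then show ?thesis using less.prems by blast
  next
    case True
    then obtain m where m: "n = p * m"
      by blast
    have p_pos: "p > 0"
      using p_ge_3 by simp
    have Bx: "poly (map_poly of_int B) \<pi> = of_nat p * (of_nat m * x)"
      using less.prems(2) by (simp add: m mult.assoc)
    then have "alg_dvd (of_nat p) (poly (map_poly of_int B) \<pi>)"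
      using assms(1) by (intro alg_dvdI[OF _ Bx] algebraic_int_times) auto
    then have "[:int p:] dvd B"
      using p_dvd_coeff_if_p_alg_dvd_poly_pi[OF less.prems(3)] by (simp add: const_poly_dvd_iff)
    then obtain C where "B = [:int p:] * C"
      by blast
    then have C: "B = smult (int p) C"
      by simp
    have "of_nat p * (of_nat m * x) = of_nat p * poly (map_poly of_int C) \<pi>"
      unfolding Bx[symmetric] C by (simp add: hom_distribs)
    then have eq: "of_nat m * x = poly (map_poly of_int C) \<pi>"
      using p_pos by simp
    have deg: "degree C < p - 1"
      using less.prems(3) p_pos by (simp add: C)
    have "m < n" "m > 0"
      using less.prems(1) p_ge_3 by (simp_all add: m)
    then show ?thesis
      by (rule less.IH[OF _ _ eq deg])
  qed
qed

lemma algebraic_int_mod_pi_squared: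
  assumes "algebraic_int x" and x: "x = ev f \<zeta>"
  obtains a b :: int and w where "algebraic_int w" "x = of_int a + of_int b * \<pi> + \<pi>\<^sup>2 * w"
proof -
  obtain d :: int and B :: "int poly" where B: "d > 0" "degree B = degree (f mod cyc)"
    "poly (map_poly of_int B) \<pi> = of_int d * ev (f mod cyc) \<zeta>"
    by (rule pi_representation)
  have "of_nat (nat d) * x = poly (map_poly of_int B) \<pi>"
    using B by (simp add: x ev_mod_cyc_zeta)
  moreover have "degree B < p - 1"
    using B(2) degree_mod_cyc by simp
  ultimately obtain m :: nat and C :: "int poly"
    where C: "\<not> p dvd m" "of_nat m * x = poly (map_poly of_int C) \<pi>"
    using clear_p_from_denominator[OF assms(1), of "nat d" B] B(1) by auto
  have "coprime (int m) (int p)"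
    using prime_imp_coprime[OF prime_p C(1)] by (simp add: coprime_commute)
  \<comment> \<open>Writing \<open>x = e * (m * x) + k * (p * x)\<close>, the first part is an
    integer polynomial in \<pi> and the second is divisible by the square of \<pi>.\<close>
  then obtain e k where ek: "e * int m + k * int p = 1"
    using bezout_int[of "int m" "int p"] by auto
  obtain t where t: "algebraic_int t" "of_nat p = \<pi>\<^sup>2 * t"
    using pi_power_2_alg_dvd_p unfolding alg_dvd_def by blast
  obtain a b D where D: "C = pCons a (pCons b D)"
    by (metis pCons_cases)
  define w where "w = of_int e * poly (map_poly of_int D) \<pi> + of_int k * t * x"
  have "x = of_int (e * int m + k * int p) * x"
    by (simp add: ek)
  also have "\<dots> = of_int e * (of_nat m * x) + of_int k * (of_nat p * x)"
    by (simp add: algebra_simps)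
  also have "\<dots> = of_int (e * a) + of_int (e * b) * \<pi> + \<pi>\<^sup>2 * w"
    unfolding C(2) t(2) D w_def
    by (simp add: hom_distribs algebra_simps power2_eq_square)
  finally have eq: "x = of_int (e * a) + of_int (e * b) * \<pi> + \<pi>\<^sup>2 * w" .
  have "algebraic_int w"
    unfolding w_def using t(1) assms(1)
    by (intro algebraic_int_plus algebraic_int_times algebraic_int_poly algebraic_int_pi
        algebraic_int_of_int)
  then show thesis
    using eq that by blast
qed

section \<open>Traces of field elements and their integrality\<close>

lemma not_dvd_if_mem: "k \<in> {1..<p} \<Longrightarrow> \<not> p dvd k"
  by (auto dest: dvd_imp_le)

lemma sum_zeta_powers_rat: "(\<Sum>k\<in>{1..<p}. (\<zeta> ^ k) ^ n) \<in> \<rat>"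
proof -
  have "(\<Sum>k<p. (\<zeta> ^ k) ^ n) = (\<Sum>k\<in>insert 0 {1..<p}. (\<zeta> ^ k) ^ n)"
    using p_ge_3 by (intro sum.cong) auto
  also have "\<dots> = 1 + (\<Sum>k\<in>{1..<p}. (\<zeta> ^ k) ^ n)"
    by (subst sum.insert) auto
  finally have eq: "(\<Sum>k\<in>{1..<p}. (\<zeta> ^ k) ^ n) = (\<Sum>k<p. (\<zeta> ^ n) ^ k) - 1"
    by (simp add: mult.commute flip: power_mult)
  show ?thesis
  proof (cases "p dvd n")
    case True
    then have "\<zeta> ^ n = 1"
      by (simp add: zeta_power_eq_1_iff)
    then show ?thesis unfolding eq by simp
  next
    case False
    then show ?thesis
      unfolding eq using ev_cyc_zeta_power[of n] by (simp add: ev_cyc)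
  qed
qed

text \<open>The trace is the case \<open>n = 0\<close>; the extra power absorbs the factor that
  appears when a coefficient is split off.\<close>

lemma trace_rat: "(\<Sum>k\<in>{1..<p}. (\<zeta> ^ k) ^ n * ev f (\<zeta> ^ k)) \<in> \<rat>"
proof (induction f arbitrary: n)
  case (pCons c f)
  have "(\<Sum>k\<in>{1..<p}. (\<zeta> ^ k) ^ n * ev (pCons c f) (\<zeta> ^ k))
      = (\<Sum>k\<in>{1..<p}. of_rat c * (\<zeta> ^ k) ^ n + (\<zeta> ^ k) ^ Suc n * ev f (\<zeta> ^ k))"
    unfolding ev_simps power_Suc by (intro sum.cong refl) (simp only: distrib_left mult_ac)
  also have "\<dots> = of_rat c * (\<Sum>k\<in>{1..<p}. (\<zeta> ^ k) ^ n)
      + (\<Sum>k\<in>{1..<p}. (\<zeta> ^ k) ^ Suc n * ev f (\<zeta> ^ k))"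
    by (simp only: sum.distrib sum_distrib_left)
  also have "\<dots> \<in> \<rat>"
    by (intro Rats_add Rats_mult pCons.IH sum_zeta_powers_rat) simp
  finally show ?case .
qed simp

text \<open>For a monic integer \<open>q\<close> with root \<open>ev f \<zeta>\<close>, the
  composition of \<open>q\<close> with \<open>f\<close> vanishes at \<zeta> and so at
  \<open>\<zeta> ^ k\<close>.\<close>

lemma algebraic_int_conjugate:
  assumes "algebraic_int (ev f \<zeta>)" and "\<not> p dvd k"
  shows "algebraic_int (ev f (\<zeta> ^ k))"
proof -
  obtain q :: "int poly" where q: "poly (map_poly of_int q) (ev f \<zeta>) = 0" "lead_coeff q = 1"
    using assms(1) unfolding algebraic_int_altdef_ipoly by blast
  have "ev (pcompose (map_poly of_int q) f) \<zeta> = 0"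
    by (simp add: ev_of_int_poly q)
  then have "ev (pcompose (map_poly of_int q) f) (\<zeta> ^ k) = 0"
    using assms(2) by (rule ev_zeta_power_eq_0)
  then show ?thesis
    unfolding algebraic_int_altdef_ipoly using q(2) by (auto simp: ev_of_int_poly)
qed

lemma trace_int:
  assumes "algebraic_int (ev f \<zeta>)"
  shows "(\<Sum>k\<in>{1..<p}. ev f (\<zeta> ^ k)) \<in> \<int>"
proof (rule rational_algebraic_int_is_int)
  show "algebraic_int (\<Sum>k\<in>{1..<p}. ev f (\<zeta> ^ k))"
    using assms by (intro algebraic_int_sum algebraic_int_conjugate not_dvd_if_mem)
  show "(\<Sum>k\<in>{1..<p}. ev f (\<zeta> ^ k)) \<in> \<rat>"
    using trace_rat[of 0 f] by simp
qed

text \<open>Conjugation inverts \<open>p\<close>-th roots of unity, that is, raises them to the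
  power \<open>p - 1\<close>. The same substitution thus works at every
  \<open>\<zeta> ^ k\<close>.\<close>

definition conj_poly :: "rat poly \<Rightarrow> rat poly" where
  "conj_poly f = pcompose f (monom 1 (p - 1))"

lemma ev_conj_poly: "ev (conj_poly f) (\<zeta> ^ k) = cnj (ev f (\<zeta> ^ k))"
  by (simp add: conj_poly_def cnj_ev cnj_zeta flip: power_mult) (simp add: mult.commute)

lemma ev_conj_poly_zeta: "ev (conj_poly f) \<zeta> = cnj (ev f \<zeta>)"
  using ev_conj_poly[of f 1] by simp

text \<open>The trace of \<open>(x * cnj x)\<^sup>n\<close> is a non-negative integer and tends to \<open>0\<close>.\<close>

lemma eq_0_if_conjugates_small:
  assumes int: "algebraic_int (ev f \<zeta>)" and c: "c < 1"
    and small: "\<And>k. k \<in> {1..<p} \<Longrightarrow> norm (ev f (\<zeta> ^ k)) \<le> c"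
  shows "ev f \<zeta> = 0"
proof -
  have c0: "0 \<le> c"
    using small[of 1] norm_ge_zero[of "ev f (\<zeta> ^ 1)"] p_ge_3 by (simp del: norm_ge_zero)
  \<comment> \<open>With each of the \<open>p - 1\<close> terms at most \<open>1 / p\<close>, their
    sum stays below \<open>1\<close>.\<close>
  obtain n where n: "c ^ n < 1 / real p"
    using real_arch_pow_inv[of "1 / real p" c] c p_ge_3 by auto
  have "n > 0"
  proof (rule ccontr)
    assume "\<not> n > 0"
    with n have "1 < 1 / real p" by simp
    then show False using p_ge_3 by (simp add: field_simps)
  qed
  define h where "h = (f * conj_poly f) ^ n"
  define s where "s k = (norm (ev f (\<zeta> ^ k)) ^ 2) ^ n" for k
  have ev_h: "ev h (\<zeta> ^ k) = of_real (s k)" for k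
    by (simp add: h_def s_def ev_conj_poly flip: complex_norm_square)
  have "algebraic_int (ev h \<zeta>)"
    unfolding h_def ev_simps ev_conj_poly_zeta using int
    by (intro algebraic_int_power algebraic_int_times algebraic_int_cnj)
  then have "complex_of_real (\<Sum>k\<in>{1..<p}. s k) \<in> \<int>"
    using trace_int[of h] by (simp add: ev_h)
  then obtain m where m: "complex_of_real (\<Sum>k\<in>{1..<p}. s k) = of_int m"
    by (auto elim: Ints_cases)
  have "complex_of_real (\<Sum>k\<in>{1..<p}. s k) = complex_of_real (real_of_int m)"
    unfolding m by simp
  then have sum_s: "(\<Sum>k\<in>{1..<p}. s k) = real_of_int m"
    unfolding of_real_eq_iff .
  have s_nonneg: "s k \<ge> 0" for k
    by (simp add: s_def)
  have s_le: "s k \<le> 1 / real p" if "k \<in> {1..<p}" for k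
  proof -
    have "norm (ev f (\<zeta> ^ k)) ^ 2 \<le> norm (ev f (\<zeta> ^ k))"
      using small[OF that] c by (simp add: power2_eq_square mult_left_le)
    also have "\<dots> \<le> c"
      by (rule small[OF that])
    finally have "s k \<le> c ^ n"
      unfolding s_def by (intro power_mono) auto
    then show ?thesis using n by simp
  qed
  have "(\<Sum>k\<in>{1..<p}. s k) \<le> real (card {1..<p}) * (1 / real p)"
    using s_le by (intro sum_bounded_above) auto
  also have "\<dots> < 1"
    using p_ge_3 by (simp add: field_simps of_nat_diff)
  finally have "m < 1"
    unfolding sum_s by simp
  moreover have "m \<ge> 0"
    using sum_nonneg[of "{1..<p}" s] s_nonneg sum_s by simp
  ultimately have "(\<Sum>k\<in>{1..<p}. s k) = 0"
    unfolding sum_s by simp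
  then have "s 1 = 0"
    using s_nonneg p_ge_3 by (subst (asm) sum_nonneg_eq_0_iff) auto
  then show ?thesis
    using \<open>n > 0\<close> by (simp add: s_def)
qed

text \<open>The congruence is used twice: modulo \<pi> it makes \<open>v ^ p - 1\<close> divisible
  by \<open>p\<close>, and modulo the square of \<pi> it excludes the nontrivial powers of
  \<zeta>.\<close>

lemma eq_1_if_unitary_and_cong_1:
  assumes v: "v = ev g \<zeta>" and int: "algebraic_int v" and unitary: "v * cnj v = 1"
    and cong: "alg_dvd (\<pi>\<^sup>2) (v - 1)"
  shows "v = 1"
proof -
  have pi_dvd: "alg_dvd \<pi> (v - 1)"
    using alg_dvd_trans[OF _ cong] alg_dvd_power_le[of 1 2 \<pi>] by simp
  have "alg_dvd (of_nat p) (\<pi> ^ (p - 1))"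
    by (rule p_alg_dvd_pi_power)
  also have "alg_dvd (\<pi> ^ (p - 1)) (\<pi> ^ p)"
    by (rule alg_dvd_power_le) auto
  also have "\<pi> ^ p = (\<Prod>k<p. \<pi>)"
    by simp
  \<comment> \<open>Each factor \<open>v - \<zeta> ^ k\<close> is split into two multiples of
    \<pi>.\<close>
  also have "alg_dvd (\<Prod>k<p. \<pi>) (\<Prod>k<p. (v - 1) + (1 - \<zeta> ^ k))"
    by (intro alg_dvd_prod alg_dvd_add pi_dvd alg_dvd_one_minus_zeta_power)
  also have "(\<Prod>k<p. (v - 1) + (1 - \<zeta> ^ k)) = v ^ p - 1"
    by (simp add: power_p_diff_1_eq_prod)
  finally obtain y where y: "algebraic_int y" "v ^ p - 1 = of_nat p * y"
    unfolding alg_dvd_def by blast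
  define f where "f = smult (1 / of_nat p) (g ^ p - 1)"
  have ev_f: "ev f z = (ev g z ^ p - 1) / of_nat p" for z
    by (simp add: f_def of_rat_divide)
  have y_eq: "ev f \<zeta> = y"
    using y(2) p_ge_3 by (simp add: ev_f flip: v)
  have "norm (ev f (\<zeta> ^ k)) \<le> 2 / 3" if k: "k \<in> {1..<p}" for k
  proof -
    \<comment> \<open>Stated as a rational relation at \<zeta>, unitarity passes to all conjugates.
      They have modulus \<open>1\<close>, so the quotient has modulus at most \<open>2 / p\<close>,
      hence at most \<open>2 / 3\<close>.\<close>
    have "ev (g * conj_poly g - 1) \<zeta> = 0"
      using unitary by (simp add: ev_conj_poly_zeta v)
    then have "ev (g * conj_poly g - 1) (\<zeta> ^ k) = 0"
      using not_dvd_if_mem[OF k] by (rule ev_zeta_power_eq_0)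
    then have "complex_of_real ((norm (ev g (\<zeta> ^ k)))\<^sup>2) = 1"
      by (simp add: ev_conj_poly flip: complex_norm_square)
    then have "(norm (ev g (\<zeta> ^ k)))\<^sup>2 = 1"
      by (metis of_real_eq_1_iff)
    then have "norm (ev g (\<zeta> ^ k)) = 1"
      by (simp add: power2_eq_1_iff)
        (metis norm_ge_zero not_one_le_zero le_minus_one_simps(3))
    then have "norm (ev g (\<zeta> ^ k) ^ p - 1) \<le> 2"
      using norm_triangle_ineq4[of "ev g (\<zeta> ^ k) ^ p" 1] by (simp add: norm_power)
    then have "norm (ev f (\<zeta> ^ k)) \<le> 2 / real p"
      by (simp add: ev_f norm_divide divide_right_mono)
    also have "\<dots> \<le> 2 / 3"
      using p_ge_3 by (simp add: field_simps)
    finally show ?thesis .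
  qed
  then have "y = 0"
    using eq_0_if_conjugates_small[of f "2 / 3"] y(1) by (simp add: y_eq)
  then have "v ^ p = 1"
    using y(2) by simp
  then have "v \<in> (\<lambda>k. \<zeta> ^ k) ` {..<p}"
    using zeta_bij by (auto simp: bij_betw_def)
  then obtain k where k: "k < p" "v = \<zeta> ^ k"
    by blast
  have "k = 0"
  proof (rule ccontr)
    assume "k \<noteq> 0"
    have "alg_dvd (\<pi>\<^sup>2) (0 - (v - 1))"
      by (intro alg_dvd_diff cong alg_dvd_0)
    then have "alg_dvd (\<pi>\<^sup>2) (1 - \<zeta> ^ k)"
      by (simp add: k)
    \<comment> \<open>The square of \<pi> would then divide \<pi>, making \<pi> a unit.\<close>
    also have "alg_dvd (1 - \<zeta> ^ k) \<pi>"
      using k \<open>k \<noteq> 0\<close> by (intro one_minus_zeta_power_alg_dvd) auto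
    finally have "alg_dvd (\<pi> * \<pi>) (\<pi> * of_int 1)"
      by (simp add: power2_eq_square)
    then have "alg_dvd \<pi> (of_int 1)"
      by (rule alg_dvd_cancel[rotated]) simp
    then show False
      using p_ge_3 unfolding pi_alg_dvd_of_int_iff by simp
  qed
  then show ?thesis
    using k by simp
qed

end

subsection \<open>The cyclotomic field and its ring of integers\<close>

lemma complex_ring_simps [simp]:
  "carrier complex_ring = UNIV" "monoid.mult complex_ring x y = x * y" "monoid.one complex_ring = 1"
  "ring.add complex_ring x y = x + y" "ring.zero complex_ring = 0"
  by (simp_all add: ring_of_type_algebra_def)

lemma complex_ring_a_inv: "a_inv complex_ring x = - x"
  and complex_ring_m_inv: "x \<noteq> 0 \<Longrightarrow> m_inv complex_ring x = inverse x"
proof -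
  interpret C: field complex_ring
    by (rule field_from_type_algebra)
  show "a_inv complex_ring x = - x"
    by (rule C.minus_equality) simp_all
  show "m_inv complex_ring x = inverse x" if "x \<noteq> 0"
    using that by (intro C.comm_inv_char) simp_all
qed

lemma cyclotomic_field_1: "1 \<in> cyclotomic_field p"
    and cyclotomic_field_zeta: "zeta p \<in> cyclotomic_field p"
    and cyclotomic_field_minus: "x \<in> cyclotomic_field p \<Longrightarrow> - x \<in> cyclotomic_field p"
    and cyclotomic_field_inverse: "x \<in> cyclotomic_field p \<Longrightarrow> inverse x \<in> cyclotomic_field p"
    and cyclotomic_field_add:
      "x \<in> cyclotomic_field p \<Longrightarrow> y \<in> cyclotomic_field p \<Longrightarrow> x + y \<in> cyclotomic_field p"
    and cyclotomic_field_mult: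
      "x \<in> cyclotomic_field p \<Longrightarrow> y \<in> cyclotomic_field p \<Longrightarrow> x * y \<in> cyclotomic_field p"
proof -
  show "1 \<in> cyclotomic_field p"
    using generate_field.one[of complex_ring "{zeta p}"] by (simp add: cyclotomic_field_def)
  show "zeta p \<in> cyclotomic_field p"
    by (simp add: cyclotomic_field_def generate_field.incl)
  show "- x \<in> cyclotomic_field p" if "x \<in> cyclotomic_field p"
    using generate_field.a_inv[of x complex_ring "{zeta p}"] that
    by (simp add: cyclotomic_field_def complex_ring_a_inv)
  show "inverse x \<in> cyclotomic_field p" if "x \<in> cyclotomic_field p"
    using generate_field.m_inv[of x complex_ring "{zeta p}"] that
    by (cases "x = 0") (simp_all add: cyclotomic_field_def complex_ring_m_inv)
  show "x + y \<in> cyclotomic_field p" if "x \<in> cyclotomic_field p" "y \<in> cyclotomic_field p"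
    using generate_field.eng_add[of x complex_ring "{zeta p}" y] that
    by (simp add: cyclotomic_field_def)
  show "x * y \<in> cyclotomic_field p" if "x \<in> cyclotomic_field p" "y \<in> cyclotomic_field p"
    using generate_field.eng_mult[of x complex_ring "{zeta p}" y] that
    by (simp add: cyclotomic_field_def)
qed

lemma cyclotomic_field_diff:
  "x \<in> cyclotomic_field p \<Longrightarrow> y \<in> cyclotomic_field p \<Longrightarrow> x - y \<in> cyclotomic_field p"
  using cyclotomic_field_add[of x p "- y"] cyclotomic_field_minus[of y p] by simp

lemma cyclotomic_field_power: "x \<in> cyclotomic_field p \<Longrightarrow> x ^ n \<in> cyclotomic_field p"
  by (induction n) (simp_all add: cyclotomic_field_1 cyclotomic_field_mult)

lemma cyclotomic_field_of_nat: "of_nat n \<in> cyclotomic_field p"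
proof (induction n)
  case 0
  show ?case
    using cyclotomic_field_diff[OF cyclotomic_field_1 cyclotomic_field_1, of p] by simp
qed (simp add: cyclotomic_field_add cyclotomic_field_1)

lemma cyclotomic_field_of_int: "of_int n \<in> cyclotomic_field p"
  by (cases n) (auto simp del: of_nat_Suc intro: cyclotomic_field_minus cyclotomic_field_of_nat)

lemma cyclotomic_integers_simps [simp]:
  "carrier (cyclotomic_integers p) = {x \<in> cyclotomic_field p. algebraic_int x}"
  "monoid.mult (cyclotomic_integers p) x y = x * y" "monoid.one (cyclotomic_integers p) = 1"
  "ring.add (cyclotomic_integers p) x y = x + y"
  by (simp_all add: cyclotomic_integers_def)

lemma cyclotomic_integers_PIdl_iff:
  "y \<in> PIdl\<^bsub>cyclotomic_integers p\<^esub> x \<longleftrightarrow>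
    (\<exists>w. w \<in> cyclotomic_field p \<and> algebraic_int w \<and> y = x * w)"
  by (auto simp: cgenideal_def mult.commute)

text \<open>The principal ideal of a unit is already the whole ring, so \<open>0\<close> suffices as
  the summand from the other ideal.\<close>

lemma coprime_elements_if_unit:
  assumes u: "u \<in> Units (cyclotomic_integers p)"
    and x: "x \<in> carrier (cyclotomic_integers p)"
  shows "coprime_elements (cyclotomic_integers p) u x"
proof -
  let ?R = "cyclotomic_integers p"
  obtain v where v: "u \<in> carrier ?R" "v \<in> carrier ?R" "u * v = 1"
    using u by (auto simp: Units_def)
  have "y \<in> PIdl\<^bsub>?R\<^esub> u <+>\<^bsub>?R\<^esub> PIdl\<^bsub>?R\<^esub> x" if "y \<in> carrier ?R" for y
  proof -
    have "y = u * (v * y)"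
      using v by (simp flip: mult.assoc)
    then have "y \<in> PIdl\<^bsub>?R\<^esub> u"
      unfolding cyclotomic_integers_PIdl_iff using v that
      by (intro exI[of _ "v * y"]) (auto intro: cyclotomic_field_mult)
    moreover have "0 \<in> PIdl\<^bsub>?R\<^esub> x"
      unfolding cyclotomic_integers_PIdl_iff using cyclotomic_field_of_nat[of 0 p]
      by (intro exI[of _ 0]) auto
    ultimately show ?thesis
      unfolding set_add_def' by force
  qed
  moreover have "PIdl\<^bsub>?R\<^esub> u <+>\<^bsub>?R\<^esub> PIdl\<^bsub>?R\<^esub> x \<subseteq> carrier ?R"
    using v x by (auto simp: set_add_def' cyclotomic_integers_PIdl_iff
      intro!: cyclotomic_field_add cyclotomic_field_mult algebraic_int_plus algebraic_int_times)
  ultimately show ?thesis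
    unfolding coprime_elements_def by blast
qed

context odd_prime
begin

text \<open>The values of rational polynomials at \<zeta> already form a field; closure under
  inverses is \<open>ev_zeta_inverse\<close>.\<close>

lemma cyclotomic_field_imp_ev: "x \<in> cyclotomic_field p \<Longrightarrow> \<exists>f. x = ev f \<zeta>"
  unfolding cyclotomic_field_def
proof (induction x rule: generate_field.induct)
  case one
  show ?case by (intro exI[of _ 1]) simp
next
  case (incl h)
  then show ?case by (intro exI[of _ "[:0, 1:]"]) simp
next
  case (a_inv h)
  then obtain f where "h = ev f \<zeta>" by blast
  then show ?case
    by (intro exI[of _ "- f"]) (simp add: complex_ring_a_inv)
next
  case (m_inv h)
  then obtain f where "h = ev f \<zeta>" by blast
  then show ?case
    using ev_zeta_inverse[of f] m_inv.hyps by (auto simp: complex_ring_m_inv dest: sym)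
next
  case (eng_add x y)
  then obtain f g where "x = ev f \<zeta>" "y = ev g \<zeta>" by blast
  then show ?case
    by (intro exI[of _ "f + g"]) simp
next
  case (eng_mult x y)
  then obtain f g where "x = ev f \<zeta>" "y = ev g \<zeta>" by blast
  then show ?case
    by (intro exI[of _ "f * g"]) simp
qed

lemma cnj_pi: "cnj \<pi> = - (\<zeta> ^ (p - 1) * \<pi>)"
proof -
  have "\<zeta> ^ (p - 1) * \<zeta> = 1"
    using p_ge_3 by (simp flip: power_Suc2)
  then show ?thesis
    by (simp add: cnj_zeta algebra_simps)
qed

text \<open>Complex conjugation acts as \<open>-1\<close> on \<open>(\<pi>) / (\<pi>\<^sup>2)\<close>, so a real element has no linear
  term in its expansion modulo \<open>\<pi>\<^sup>2\<close>.\<close>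

lemma real_imp_cong_of_int:
  assumes x: "x \<in> cyclotomic_field p" "algebraic_int x" and real: "cnj x = x"
  shows "\<exists>a :: int. alg_dvd (\<pi>\<^sup>2) (x - of_int a)"
proof -
  obtain f where "x = ev f \<zeta>"
    using cyclotomic_field_imp_ev[OF x(1)] by blast
  then obtain a b :: int and w
    where w: "algebraic_int w" "x = of_int a + of_int b * \<pi> + \<pi>\<^sup>2 * w"
    by (rule algebraic_int_mod_pi_squared[OF x(2)])
  \<comment> \<open>This is the inverse of \<zeta>. It is congruent to \<open>1\<close> modulo
    \<pi>, so the conjugate \<open>- z * \<pi>\<close> of \<pi> is congruent to
    \<open>- \<pi>\<close> modulo the square of \<pi>.\<close>
  define z where "z = \<zeta> ^ (p - 1)"
  have z: "algebraic_int z"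
    unfolding z_def by (intro algebraic_int_power algebraic_int_zeta)
  have "z * \<zeta> = 1"
    using p_ge_3 by (simp add: z_def flip: power_Suc2)
  then have z_zeta: "z * (\<zeta> * t) = t" for t
    by (simp flip: mult.assoc)
  have z_pi: "z * \<pi> = \<pi> + z * \<pi>\<^sup>2"
    using \<open>z * \<zeta> = 1\<close> by (simp add: power2_eq_square algebra_simps z_zeta)
  have "x = cnj x"
    by (simp add: real)
  also have "\<dots> = of_int a + of_int b * cnj \<pi> + (cnj \<pi>)\<^sup>2 * cnj w"
    unfolding w(2) by simp
  also have "\<dots> = of_int a - of_int b * (z * \<pi>) + (z * \<pi>)\<^sup>2 * cnj w"
    unfolding cnj_pi z_def by simp
  also have "\<dots> = of_int a - of_int b * (\<pi> + z * \<pi>\<^sup>2) + (z * \<pi>)\<^sup>2 * cnj w"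
    unfolding z_pi[symmetric] ..
  \<comment> \<open>Equating the expansions of \<open>x\<close> and its conjugate shows that \<pi>
    divides \<open>2 * b\<close>; as \<open>p\<close> is odd, it follows that \<open>p\<close>
    divides \<open>b\<close>.\<close>
  finally have "\<pi> * of_int (2 * b) = \<pi> * (\<pi> * (z\<^sup>2 * cnj w - of_int b * z - w))"
    unfolding w(2) by (simp add: algebra_simps power2_eq_square)
  then have "of_int (2 * b) = \<pi> * (z\<^sup>2 * cnj w - of_int b * z - w)"
    unfolding mult_cancel_left by simp
  then have "alg_dvd \<pi> (of_int (2 * b))"
    using w(1) z by (intro alg_dvdI[rotated]) (assumption,
      intro algebraic_int_diff algebraic_int_times algebraic_int_power algebraic_int_cnj algebraic_int_of_int)
  then have "int p dvd 2 * b"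
    by (simp only: pi_alg_dvd_of_int_iff)
  moreover have "coprime (int p) 2"
    using odd_p by simp
  ultimately have "int p dvd b"
    by (simp add: coprime_dvd_mult_right_iff)
  then have "alg_dvd \<pi> (of_int b)"
    by (simp only: pi_alg_dvd_of_int_iff)
  then have "alg_dvd (\<pi> * \<pi>) (of_int b * \<pi>)"
    by (intro alg_dvd_mult) simp_all
  then have "alg_dvd (\<pi>\<^sup>2) (of_int b * \<pi>)"
    by (simp only: power2_eq_square)
  moreover have "alg_dvd (\<pi>\<^sup>2) (\<pi>\<^sup>2 * w)"
    using w(1) by (rule alg_dvdI) simp
  ultimately have "alg_dvd (\<pi>\<^sup>2) (of_int b * \<pi> + \<pi>\<^sup>2 * w)"
    by (rule alg_dvd_add)
  also have "of_int b * \<pi> + \<pi>\<^sup>2 * w = x - of_int a"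
    by (simp add: w(2))
  finally show ?thesis ..
qed

text \<open>As \<pi> and its conjugate are associated, \<open>u\<close> and \<open>cnj u\<close> are
  congruent to the same integer. Multiplying by \<open>cnj v\<close>, the inverse of
  \<open>cnj u\<close>, gives a unitary element congruent to \<open>1\<close>.\<close>

lemma unit_real_if_cong_of_int:
  assumes u: "u \<in> cyclotomic_field p" "algebraic_int u"
    and v: "v \<in> cyclotomic_field p" "algebraic_int v" and uv: "u * v = 1"
    and cong: "alg_dvd (\<pi>\<^sup>2) (u - of_int a)"
  shows "cnj u = u"
proof -
  obtain f g where fg: "u = ev f \<zeta>" "v = ev g \<zeta>"
    using cyclotomic_field_imp_ev[OF u(1)] cyclotomic_field_imp_ev[OF v(1)] by blast
  have cuv: "cnj u * cnj v = 1"
    by (simp flip: complex_cnj_mult add: uv)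
  obtain w where w: "algebraic_int w" "u - of_int a = \<pi>\<^sup>2 * w"
    using cong unfolding alg_dvd_def by blast
  have "cnj (u - of_int a) = cnj (\<pi>\<^sup>2 * w)"
    by (simp only: w(2))
  then have "cnj u - of_int a = (cnj \<pi>)\<^sup>2 * cnj w"
    by simp
  also have "\<dots> = \<pi>\<^sup>2 * ((\<zeta> ^ (p - 1))\<^sup>2 * cnj w)"
    unfolding cnj_pi by (simp add: power_mult_distrib)
  finally have "alg_dvd (\<pi>\<^sup>2) (cnj u - of_int a)"
    using w(1) by (intro alg_dvdI[rotated]) (assumption,
      intro algebraic_int_times algebraic_int_power algebraic_int_zeta algebraic_int_cnj)
  with cong have "alg_dvd (\<pi>\<^sup>2) ((u - of_int a) - (cnj u - of_int a))"
    by (rule alg_dvd_diff)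
  then have "alg_dvd (\<pi>\<^sup>2) ((u - cnj u) * cnj v)"
    using v(2) by (intro alg_dvd_mult_right) auto
  moreover have "(u - cnj u) * cnj v = u * cnj v - 1"
    by (simp add: left_diff_distrib cuv)
  ultimately have "alg_dvd (\<pi>\<^sup>2) (u * cnj v - 1)"
    by simp
  moreover have "u * cnj v * cnj (u * cnj v) = 1"
    using uv cuv by (simp add: mult_ac)
  moreover have "u * cnj v = ev (f * conj_poly g) \<zeta>"
    by (simp add: fg ev_conj_poly_zeta)
  moreover have "algebraic_int (u * cnj v)"
    using u(2) v(2) by (intro algebraic_int_times algebraic_int_cnj)
  ultimately have "u * cnj v = 1"
    using eq_1_if_unitary_and_cong_1 by blast
  then have "u * cnj v = cnj u * cnj v"
    by (simp add: cuv)
  moreover have "cnj v \<noteq> 0"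
    using uv by auto
  ultimately show ?thesis
    by simp
qed

text \<open>The algebraic integer quotient lies in the cyclotomic field because it is a quotient of
  two field elements.\<close>

lemma pi_squared_alg_dvd_imp_mem_PIdl:
  assumes "x \<in> cyclotomic_field p" and "alg_dvd (\<pi>\<^sup>2) x"
  shows "x \<in> PIdl\<^bsub>cyclotomic_integers p\<^esub> (\<pi>\<^sup>2)"
proof -
  obtain w where w: "algebraic_int w" "x = \<pi>\<^sup>2 * w"
    using assms(2) unfolding alg_dvd_def by blast
  then have "w = x * inverse (\<pi>\<^sup>2)"
    by simp
  also have "\<dots> \<in> cyclotomic_field p"
    by (intro cyclotomic_field_mult cyclotomic_field_inverse cyclotomic_field_power
        cyclotomic_field_diff cyclotomic_field_1 cyclotomic_field_zeta assms(1))
  finally show ?thesis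
    unfolding cyclotomic_integers_PIdl_iff using w by blast
qed

end

theorem theorem1:
  fixes p :: nat and u :: complex
  assumes "Factorial_Ring.prime p" and "odd p"
    and "u \<in> Units (cyclotomic_integers p)"
  shows "u \<in> \<real> \<longleftrightarrow> primary p u"
proof -
  interpret odd_prime p
    by unfold_locales (fact assms)+
  obtain v where u: "u \<in> cyclotomic_field p" "algebraic_int u"
    and v: "v \<in> cyclotomic_field p" "algebraic_int v" and uv: "u * v = 1"
    using assms(3) by (auto simp: Units_def)
  show ?thesis
  proof
    assume "u \<in> \<real>"
    then obtain a :: int where "alg_dvd (\<pi>\<^sup>2) (u - of_int a)"
      using real_imp_cong_of_int[OF u] by (auto simp: Reals_cnj_iff)
    then have "u - of_int a \<in> PIdl\<^bsub>cyclotomic_integers p\<^esub> (\<pi>\<^sup>2)"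
      by (intro pi_squared_alg_dvd_imp_mem_PIdl cyclotomic_field_diff u(1) cyclotomic_field_of_int)
    moreover have "coprime_elements (cyclotomic_integers p) u (of_nat p)"
      by (intro coprime_elements_if_unit assms(3)) (simp add: cyclotomic_field_of_nat)
    ultimately show "primary p u"
      unfolding primary_def using u by auto
  next
    assume "primary p u"
    then obtain a :: int where "u - of_int a \<in> PIdl\<^bsub>cyclotomic_integers p\<^esub> (\<pi>\<^sup>2)"
      unfolding primary_def by blast
    then have "alg_dvd (\<pi>\<^sup>2) (u - of_int a)"
      unfolding cyclotomic_integers_PIdl_iff alg_dvd_def by blast
    then have "cnj u = u"
      by (rule unit_real_if_cong_of_int[OF u v uv])
    then show "u \<in> \<real>"
      by (simp add: Reals_cnj_iff)
  qed
qed

end
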